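(* Let $K=\mathbb{C}$ or $K=\mathbb{R}$. Up to linear equivalence there are only finitely many polynomial quadratic mappings $f:K^2\to K^2$; that is, there are finitely many mappings $g_1,\dots,g_N\in\Omega_K(2,2)$ such that every $f\in\Omega_K(2,2)$ is linearly equivalent over $K$ to some $g_i$.
   Context: $\Omega_K(2,2)$ is the set of polynomial mappings $f=(f_1,f_2):K^2\to K^2$ with $\deg f_1\le 2$ and $\deg f_2\le 2$. Mappings $f,g\in\Omega_K(2,2)$ are linearly equivalent over $K$ if there are affine automorphisms $L,R$ of $K^2$ (invertible affine transformations, translations allowed) such that $f=L\circ g\circ R$. *)

theory Defs
  imports "HOL-Analysis.Analysis"
begin

text \<open>
  A map is a polynomial function of total degree at most \<open>d\<close> if it is given by a sum of monomials
  \<open>c i j * x ^ i * y ^ j\<close> with \<open>i + j \<le> d\<close>. Over an infinite field the polynomial, hence its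
  degree, is determined by the function, so polynomial mappings may be taken to be functions.
\<close>

definition poly_fun_deg_le :: "nat \<Rightarrow> ('a::field ^ 2 \<Rightarrow> 'a) \<Rightarrow> bool" where
  "poly_fun_deg_le d p \<longleftrightarrow>
     (\<exists>c :: nat \<Rightarrow> nat \<Rightarrow> 'a. \<forall>v. p v = (\<Sum>i\<le>d. \<Sum>j\<le>d - i. c i j * (v $ 1) ^ i * (v $ 2) ^ j))"

definition Omega :: "nat \<Rightarrow> nat \<Rightarrow> ('a::field ^ 2 \<Rightarrow> 'a ^ 2) set" where
  "Omega d1 d2 = {f. poly_fun_deg_le d1 (\<lambda>v. f v $ 1) \<and> poly_fun_deg_le d2 (\<lambda>v. f v $ 2)}"

definition affine_automorphism :: "('a::field ^ 2 \<Rightarrow> 'a ^ 2) \<Rightarrow> bool" where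
  "affine_automorphism L \<longleftrightarrow> (\<exists>A b. invertible A \<and> L = (\<lambda>v. A *v v + b))"

definition linearly_equivalent :: "('a::field ^ 2 \<Rightarrow> 'a ^ 2) \<Rightarrow> ('a ^ 2 \<Rightarrow> 'a ^ 2) \<Rightarrow> bool" where
  "linearly_equivalent f g \<longleftrightarrow>
     (\<exists>L R. affine_automorphism L \<and> affine_automorphism R \<and> f = L \<circ> g \<circ> R)"

end

theory Submission
  imports Defs
begin

text \<open>
  Constants are absorbed by the affine map on the left, so a quadratic map is a pair
  \<open>(q\<^sub>1 + l\<^sub>1, q\<^sub>2 + l\<^sub>2)\<close> of quadratic forms plus linear forms. The proof brings such a pair into one of
  21 explicit normal forms, according to the dimension of the span of \<open>q\<^sub>1\<close> and \<open>q\<^sub>2\<close>.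

  If the span is at most a line (\<open>classified_if_quadratic_parts_dependent\<close>), a left combination
  makes the second component linear. If that component vanishes, the other one is a single
  polynomial of degree at most two and is treated like the equation of a conic. Otherwise it becomes the coordinate \<open>y\<close>; completing
  the square then works, and every multiple of \<open>y\<close> in the first component can be subtracted.

  If the span is a plane (\<open>classified_if_quadratic_parts_independent\<close>), it is a pencil of binary
  quadratic forms. Unless it is \<open>\<langle>x\<^sup>2, y\<^sup>2\<rangle>\<close> from the start, elimination exhibits a product of two independent
  linear forms in it; taking these as coordinates gives \<open>\<langle>x y, \<alpha> x\<^sup>2 + \<gamma> y\<^sup>2\<rangle>\<close>. Up to coordinate change only the
  pencils \<open>\<langle>x\<^sup>2, x y\<rangle>\<close>, \<open>\<langle>x\<^sup>2, y\<^sup>2\<rangle>\<close> and \<open>\<langle>x\<^sup>2 - y\<^sup>2, x y\<rangle>\<close> remain, the last one being spanned by the real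
  and imaginary part of \<open>(x + i y)\<^sup>2\<close>. What is left are four coefficients of linear terms; translations
  remove two of them, and the linear changes preserving the pencil normalise the other two.
  For \<open>\<langle>x\<^sup>2, y\<^sup>2\<rangle>\<close> this requires a cube root, for \<open>\<langle>x\<^sup>2 - y\<^sup>2, x y\<rangle>\<close> a complex cube root.

  Both fields are treated at once: the argument runs over any field of characteristic 0 in which
  every element is a square up to sign, cube roots exist, and, in case \<open>- 1\<close> is no square, the
  equation \<open>z\<^sup>2 = \<beta> * cnj z\<close> has a nonzero solution in the field extended by \<open>i\<close>, for each nonzero \<open>\<beta>\<close>.
\<close>

section \<open>Linear equivalence in coordinates\<close>

lemma affine_automorphism_comp:
  assumes "affine_automorphism L" "affine_automorphism M"
  shows "affine_automorphism (L \<circ> M)"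
proof -
  obtain A b where A: "invertible A" "L = (\<lambda>v. A *v v + b)"
    using assms(1) unfolding affine_automorphism_def by blast
  obtain B c where B: "invertible B" "M = (\<lambda>v. B *v v + c)"
    using assms(2) unfolding affine_automorphism_def by blast
  have "L \<circ> M = (\<lambda>v. (A ** B) *v v + (A *v c + b))"
    using A B by (auto simp: fun_eq_iff matrix_vector_mul_assoc matrix_vector_right_distrib)
  then show ?thesis
    using A B invertible_mult unfolding affine_automorphism_def by blast
qed

lemma affine_automorphism_inverse:
  assumes "affine_automorphism L"
  obtains L' where "affine_automorphism L'" "L \<circ> L' = id" "L' \<circ> L = id"
proof -
  obtain A b where A: "invertible A" "L = (\<lambda>v. A *v v + b)"
    using assms unfolding affine_automorphism_def by blast
  obtain B where B: "A ** B = mat 1" "B ** A = mat 1"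
    using A(1) unfolding invertible_def by blast
  let ?L' = "\<lambda>v. B *v v + - (B *v b)"
  have "affine_automorphism ?L'"
    unfolding affine_automorphism_def using B invertible_def by blast
  moreover have "L \<circ> ?L' = id" "?L' \<circ> L = id"
    using A B
    by (auto simp: fun_eq_iff matrix_vector_mul_assoc matrix_vector_right_distrib
        matrix_vector_mult_diff_distrib)
  ultimately show ?thesis using that by blast
qed

lemma linearly_equivalent_trans:
  assumes "linearly_equivalent f g" "linearly_equivalent g h"
  shows "linearly_equivalent f h"
proof -
  obtain L R where 1: "affine_automorphism L" "affine_automorphism R" "f = L \<circ> g \<circ> R"
    using assms(1) unfolding linearly_equivalent_def by blast
  obtain L' R' where 2: "affine_automorphism L'" "affine_automorphism R'" "g = L' \<circ> h \<circ> R'"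
    using assms(2) unfolding linearly_equivalent_def by blast
  have "f = (L \<circ> L') \<circ> h \<circ> (R' \<circ> R)"
    using 1 2 by (simp add: comp_assoc)
  then show ?thesis
    using 1 2 affine_automorphism_comp unfolding linearly_equivalent_def by blast
qed

lemma linearly_equivalent_refl: "linearly_equivalent f f"
proof -
  have "affine_automorphism (id :: 'a::field ^ 2 \<Rightarrow> 'a ^ 2)"
    unfolding affine_automorphism_def
    by (rule exI[of _ "mat 1"], rule exI[of _ 0]) (auto simp: invertible_def fun_eq_iff)
  moreover have "f = id \<circ> f \<circ> id" by simp
  ultimately show ?thesis unfolding linearly_equivalent_def by blast
qed

text \<open>
  Writing all three affine maps on the side where they act forwards avoids computing inverses: each
  normalisation below is then a polynomial identity.
\<close>

lemma linearly_equivalent_if_intertwined: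
  assumes "affine_automorphism L" "affine_automorphism R" "affine_automorphism M"
    and "M \<circ> f \<circ> R = L \<circ> g"
  shows "linearly_equivalent f g"
proof -
  obtain M' where M': "affine_automorphism M'" "M' \<circ> M = id"
    using affine_automorphism_inverse[OF assms(3)] by blast
  obtain R' where R': "affine_automorphism R'" "R \<circ> R' = id"
    using affine_automorphism_inverse[OF assms(2)] by blast
  have "f = (M' \<circ> M) \<circ> f \<circ> (R \<circ> R')"
    using M' R' by simp
  also have "\<dots> = M' \<circ> (M \<circ> f \<circ> R) \<circ> R'"
    by (simp add: comp_assoc)
  also have "\<dots> = (M' \<circ> L) \<circ> g \<circ> R'"
    unfolding assms(4) by (simp add: comp_assoc)
  finally show ?thesis
    using M' R' assms(1) affine_automorphism_comp unfolding linearly_equivalent_def by blast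
qed

definition planar :: "('a \<Rightarrow> 'a \<Rightarrow> 'a) \<Rightarrow> ('a \<Rightarrow> 'a \<Rightarrow> 'a) \<Rightarrow> 'a::field ^ 2 \<Rightarrow> 'a ^ 2" where
  "planar F G = (\<lambda>v. vector [F (v $ 1) (v $ 2), G (v $ 1) (v $ 2)])"

lemma planar_nth [simp]:
  "planar F G v $ 1 = F (v $ 1) (v $ 2)" "planar F G v $ 2 = G (v $ 1) (v $ 2)"
  by (simp_all add: planar_def)

lemma affine_automorphism_planar:
  fixes p q r s h k :: "'a::field"
  assumes "p * s - q * r \<noteq> 0"
  shows "affine_automorphism (planar (\<lambda>x y. p * x + q * y + h) (\<lambda>x y. r * x + s * y + k))"
proof -
  let ?A = "vector [vector [p, q], vector [r, s]] :: 'a ^ 2 ^ 2"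
  have "invertible ?A"
    using assms by (simp add: invertible_det_nz det_2)
  moreover have "planar (\<lambda>x y. p * x + q * y + h) (\<lambda>x y. r * x + s * y + k)
      = (\<lambda>v. ?A *v v + vector [h, k])"
    by (simp add: fun_eq_iff vec_eq_iff forall_2 matrix_vector_mult_def sum_2)
  ultimately show ?thesis
    unfolding affine_automorphism_def by blast
qed

lemma linearly_equivalent_planarI:
  fixes F G F' G' :: "'a::field \<Rightarrow> 'a \<Rightarrow> 'a"
  assumes "p * s - q * r \<noteq> 0" "m\<^sub>1 * m\<^sub>4 - m\<^sub>2 * m\<^sub>3 \<noteq> 0" "n\<^sub>1 * n\<^sub>4 - n\<^sub>2 * n\<^sub>3 \<noteq> 0"
    and "\<And>x y. m\<^sub>1 * F (p * x + q * y + h) (r * x + s * y + k)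
               + m\<^sub>2 * G (p * x + q * y + h) (r * x + s * y + k)
             = n\<^sub>1 * F' x y + n\<^sub>2 * G' x y + t\<^sub>1"
    and "\<And>x y. m\<^sub>3 * F (p * x + q * y + h) (r * x + s * y + k)
               + m\<^sub>4 * G (p * x + q * y + h) (r * x + s * y + k)
             = n\<^sub>3 * F' x y + n\<^sub>4 * G' x y + t\<^sub>2"
  shows "linearly_equivalent (planar F G) (planar F' G')"
proof (rule linearly_equivalent_if_intertwined)
  let ?R = "planar (\<lambda>x y. p * x + q * y + h) (\<lambda>x y. r * x + s * y + k)"
  let ?M = "planar (\<lambda>x y. m\<^sub>1 * x + m\<^sub>2 * y + 0) (\<lambda>x y. m\<^sub>3 * x + m\<^sub>4 * y + 0)"
  let ?L = "planar (\<lambda>x y. n\<^sub>1 * x + n\<^sub>2 * y + t\<^sub>1) (\<lambda>x y. n\<^sub>3 * x + n\<^sub>4 * y + t\<^sub>2)"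
  show "affine_automorphism ?L" "affine_automorphism ?R" "affine_automorphism ?M"
    using assms(1-3) affine_automorphism_planar by blast+
  show "?M \<circ> planar F G \<circ> ?R = ?L \<circ> planar F' G'"
    using assms(4,5) by (simp add: fun_eq_iff vec_eq_iff forall_2)
qed

section \<open>Quadratic maps and their normal forms\<close>

text \<open>
  A quadratic polynomial without constant term; constants are carried by the affine map on the left.
\<close>

definition quad :: "'a::field \<Rightarrow> 'a \<Rightarrow> 'a \<Rightarrow> 'a \<Rightarrow> 'a \<Rightarrow> 'a \<Rightarrow> 'a \<Rightarrow> 'a" where
  "quad a b c d e x y = a * x\<^sup>2 + b * x * y + c * y\<^sup>2 + d * x + e * y"

lemma poly_fun_deg_le_2_iff:
  "poly_fun_deg_le 2 p \<longleftrightarrow>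
     (\<exists>a b c d e t. \<forall>v. p v = quad a b c d e (v $ 1) (v $ 2) + t)" (is "?l \<longleftrightarrow> ?r")
proof
  assume ?l
  then obtain k :: "nat \<Rightarrow> nat \<Rightarrow> 'a" where
    k: "\<And>v. p v = (\<Sum>i\<le>2. \<Sum>j\<le>2 - i. k i j * (v $ 1) ^ i * (v $ 2) ^ j)"
    unfolding poly_fun_deg_le_def by blast
  have "p v = quad (k 2 0) (k 1 1) (k 0 2) (k 1 0) (k 0 1) (v $ 1) (v $ 2) + k 0 0" for v
    unfolding k quad_def by (simp add: numeral_2_eq_2 algebra_simps)
  then show ?r by blast
next
  assume ?r
  then obtain a b c d e t where
    p: "\<And>v. p v = quad a b c d e (v $ 1) (v $ 2) + t" by blast
  define k where "k i j = (if i = 0 then if j = 0 then t else if j = 1 then e else c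
    else if i = 1 then if j = 0 then d else b else a)" for i j :: nat
  have "p v = (\<Sum>i\<le>2. \<Sum>j\<le>2 - i. k i j * (v $ 1) ^ i * (v $ 2) ^ j)" for v
    unfolding p quad_def k_def by (simp add: numeral_2_eq_2 algebra_simps)
  then show ?l unfolding poly_fun_deg_le_def by blast
qed

text \<open>
  The list is ordered by the dimension of the span of the two quadratic parts: three maps with
  dimension 0, ten with dimension 1, eight with dimension 2. The last two are \<open>z\<^sup>2\<close> and
  \<open>z\<^sup>2 + cnj z\<close> for \<open>z = x + i y\<close>.
\<close>

definition normal_forms :: "('a::field ^ 2 \<Rightarrow> 'a ^ 2) set" where
  "normal_forms =
    {planar (quad 0 0 0 0 0) (quad 0 0 0 0 0),
     planar (quad 0 0 0 1 0) (quad 0 0 0 0 0),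
     planar (quad 0 0 0 1 0) (quad 0 0 0 0 1),
     planar (quad 1 0 0 0 0) (quad 0 0 0 0 0),
     planar (quad 1 0 0 0 1) (quad 0 0 0 0 0),
     planar (quad 1 0 1 0 0) (quad 0 0 0 0 0),
     planar (quad 1 0 (-1) 0 0) (quad 0 0 0 0 0),
     planar (quad 1 0 0 0 0) (quad 0 0 0 0 1),
     planar (quad 1 0 1 0 0) (quad 0 0 0 0 1),
     planar (quad 1 0 (-1) 0 0) (quad 0 0 0 0 1),
     planar (quad 0 1 0 0 0) (quad 0 0 0 0 1),
     planar (quad 0 0 1 0 0) (quad 0 0 0 0 1),
     planar (quad 0 0 1 1 0) (quad 0 0 0 0 1),
     planar (quad 1 0 0 0 0) (quad 0 0 1 0 0),
     planar (quad 1 0 0 0 1) (quad 0 0 1 0 0),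
     planar (quad 1 0 0 0 1) (quad 0 0 1 1 0),
     planar (quad 1 0 0 0 0) (quad 0 1 0 0 0),
     planar (quad 1 0 0 1 0) (quad 0 1 0 0 0),
     planar (quad 1 0 0 0 1) (quad 0 1 0 0 0),
     planar (quad 1 0 (-1) 0 0) (quad 0 2 0 0 0),
     planar (quad 1 0 (-1) 1 0) (quad 0 2 0 0 (-1))}"

lemma normal_forms_subset: "normal_forms \<subseteq> Omega 2 2"
proof -
  have quadratic: "poly_fun_deg_le 2 (\<lambda>v. quad a b c d e (v $ 1) (v $ 2))" for a b c d e :: 'a
    unfolding poly_fun_deg_le_2_iff by (intro exI[of _ a] exI[of _ b] exI[of _ c] exI[of _ d]
        exI[of _ e] exI[of _ 0]) simp
  show ?thesis
    unfolding normal_forms_def Omega_def by (simp add: quadratic)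
qed

definition classified :: "('a::field ^ 2 \<Rightarrow> 'a ^ 2) \<Rightarrow> bool" where
  "classified f \<longleftrightarrow> (\<exists>g\<in>normal_forms. linearly_equivalent f g)"

lemma classified_normal_form: "g \<in> normal_forms \<Longrightarrow> classified g"
  unfolding classified_def using linearly_equivalent_refl by blast

lemma classified_equivalent: "linearly_equivalent f g \<Longrightarrow> classified g \<Longrightarrow> classified f"
  unfolding classified_def using linearly_equivalent_trans by blast

lemma classified_substitute:
  fixes F G F' G' :: "'a::field \<Rightarrow> 'a \<Rightarrow> 'a"
  assumes "classified (planar F' G')"
    and "p * s - q * r \<noteq> 0" "n\<^sub>1 * n\<^sub>4 - n\<^sub>2 * n\<^sub>3 \<noteq> 0"
    and "\<And>x y. F (p * x + q * y + h) (r * x + s * y + k) = n\<^sub>1 * F' x y + n\<^sub>2 * G' x y + t\<^sub>1"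
    and "\<And>x y. G (p * x + q * y + h) (r * x + s * y + k) = n\<^sub>3 * F' x y + n\<^sub>4 * G' x y + t\<^sub>2"
  shows "classified (planar F G)"
  by (rule classified_equivalent[OF linearly_equivalent_planarI[where m\<^sub>1=1 and m\<^sub>2=0 and m\<^sub>3=0
          and m\<^sub>4=1 and h=h and k=k and t\<^sub>1=t\<^sub>1 and t\<^sub>2=t\<^sub>2, OF assms(2) _ assms(3)] assms(1)])
    (simp_all add: assms(4,5))

text \<open>
  As long as only the pencil of quadratic parts is being normalised, the linear parts may change
  arbitrarily. Quantifying over them in the first premise leaves identities between quadratic forms.
\<close>

lemma classified_by_quadratic_part:
  fixes a b c a' b' c' :: "'a::field"
  assumes "\<And>d e d' e'. classified (planar (quad A B C d e) (quad A' B' C' d' e'))"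
    and "p * s - q * r \<noteq> 0" "m\<^sub>1 * m\<^sub>4 - m\<^sub>2 * m\<^sub>3 \<noteq> 0"
    and "\<And>x y. m\<^sub>1 * quad a b c 0 0 (p * x + q * y) (r * x + s * y)
             + m\<^sub>2 * quad a' b' c' 0 0 (p * x + q * y) (r * x + s * y) = quad A B C 0 0 x y"
    and "\<And>x y. m\<^sub>3 * quad a b c 0 0 (p * x + q * y) (r * x + s * y)
             + m\<^sub>4 * quad a' b' c' 0 0 (p * x + q * y) (r * x + s * y) = quad A' B' C' 0 0 x y"
  shows "classified (planar (quad a b c d e) (quad a' b' c' d' e'))"
proof -
  have split: "quad a b c d e x y = quad a b c 0 0 x y + (d * x + e * y)" for a b c d e x y :: 'a
    by (simp add: quad_def)
  define D E D' E' where linear: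
    "D = m\<^sub>1 * (d * p + e * r) + m\<^sub>2 * (d' * p + e' * r)"
    "E = m\<^sub>1 * (d * q + e * s) + m\<^sub>2 * (d' * q + e' * s)"
    "D' = m\<^sub>3 * (d * p + e * r) + m\<^sub>4 * (d' * p + e' * r)"
    "E' = m\<^sub>3 * (d * q + e * s) + m\<^sub>4 * (d' * q + e' * s)"
  have "linearly_equivalent (planar (quad a b c d e) (quad a' b' c' d' e'))
    (planar (quad A B C D E) (quad A' B' C' D' E'))"
  proof (rule linearly_equivalent_planarI[where p=p and q=q and h=0 and r=r and s=s and k=0
        and m\<^sub>1=m\<^sub>1 and m\<^sub>2=m\<^sub>2 and m\<^sub>3=m\<^sub>3 and m\<^sub>4=m\<^sub>4
        and n\<^sub>1=1 and n\<^sub>2=0 and n\<^sub>3=0 and n\<^sub>4=1 and t\<^sub>1=0 and t\<^sub>2=0, OF assms(2,3)])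
    fix x y
    let ?x = "p * x + q * y" and ?y = "r * x + s * y"
    show "m\<^sub>1 * quad a b c d e (?x + 0) (?y + 0) + m\<^sub>2 * quad a' b' c' d' e' (?x + 0) (?y + 0)
        = 1 * quad A B C D E x y + 0 * quad A' B' C' D' E' x y + 0"
      using assms(4)[of x y] split[of a b c d e ?x ?y] split[of a' b' c' d' e' ?x ?y]
        split[of A B C D E x y]
      by (simp add: linear algebra_simps)
    show "m\<^sub>3 * quad a b c d e (?x + 0) (?y + 0) + m\<^sub>4 * quad a' b' c' d' e' (?x + 0) (?y + 0)
        = 0 * quad A B C D E x y + 1 * quad A' B' C' D' E' x y + 0"
      using assms(5)[of x y] split[of a b c d e ?x ?y] split[of a' b' c' d' e' ?x ?y]
        split[of A' B' C' D' E' x y]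
      by (simp add: linear algebra_simps)
  qed simp
  then show ?thesis
    using assms(1) classified_equivalent by blast
qed

section \<open>The arithmetic of the base field\<close>

text \<open>
  With \<open>\<beta> = p + i q\<close> and \<open>z = u + i v\<close>, the equations in the last axiom say \<open>z\<^sup>2 = \<beta> * cnj z\<close>.
  The axiom is restricted to fields without \<open>i\<close>: over \<open>\<complex>\<close> the pair \<open>(u, v)\<close> would range over the algebra
  \<open>\<complex> \<times> \<complex>\<close> with swapped factors, where the equation fails to have nonzero solutions if \<open>\<beta>\<close> is a zero divisor.
\<close>

class quadratic_normalization_field = field_char_0 +
  assumes square_up_to_sign: "\<exists>t. a = t\<^sup>2 \<or> a = - (t\<^sup>2)"
    and cube_root: "\<exists>t. t ^ 3 = a"
    and twisted_square: "p \<noteq> 0 \<or> q \<noteq> 0 \<Longrightarrow> (\<nexists>i. i\<^sup>2 = - 1) \<Longrightarrow>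
      (\<exists>u v. (u \<noteq> 0 \<or> v \<noteq> 0) \<and> u\<^sup>2 - v\<^sup>2 = p * u + q * v \<and> 2 * u * v = q * u - p * v)"

lemma signed_square_cases:
  fixes a :: "'a::quadratic_normalization_field"
  assumes "a \<noteq> 0"
  obtains t \<sigma> where "t \<noteq> 0" "a = \<sigma> * t\<^sup>2" "\<sigma> = 1 \<or> \<sigma> = - 1"
proof -
  obtain t where t: "a = t\<^sup>2 \<or> a = - (t\<^sup>2)"
    using square_up_to_sign by blast
  then have "t \<noteq> 0" using assms by auto
  then show ?thesis using that[of t 1] that[of t "- 1"] t by auto
qed

section \<open>Dependent quadratic parts\<close>

lemma classified_second_zero_diagonal:
  fixes c e :: "'a::quadratic_normalization_field"
  shows "classified (planar (quad 1 0 c 0 e) (quad 0 0 0 0 0))"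
proof (cases "c = 0")
  case True
  show ?thesis
  proof (cases "e = 0")
    case True
    then show ?thesis using \<open>c = 0\<close>
      by (intro classified_normal_form) (simp add: normal_forms_def)
  next
    case False
    have "classified (planar (quad 1 0 0 0 1) (quad 0 0 0 0 0 :: 'a \<Rightarrow> 'a \<Rightarrow> 'a))"
      by (intro classified_normal_form) (simp add: normal_forms_def)
    then show ?thesis
      by (rule classified_substitute[where p=1 and q=0 and h=0 and r=0 and s="1/e" and k=0
            and n\<^sub>1=1 and n\<^sub>2=0 and n\<^sub>3=0 and n\<^sub>4=1 and t\<^sub>1=0 and t\<^sub>2=0])
        (use False True in \<open>auto simp: quad_def\<close>)
  qed
next
  case False
  then obtain t \<sigma> where t: "t \<noteq> 0" "c = \<sigma> * t\<^sup>2" "\<sigma> = 1 \<or> \<sigma> = - 1"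
    by (rule signed_square_cases)
  have "classified (planar (quad 1 0 \<sigma> 0 0) (quad 0 0 0 0 0 :: 'a \<Rightarrow> 'a \<Rightarrow> 'a))"
    using t(3) by (intro classified_normal_form) (auto simp: normal_forms_def)
  then show ?thesis
    by (rule classified_substitute[where p=1 and q=0 and h=0 and r=0 and s="1/t" and k="- e / (2 * c)"
          and n\<^sub>1=1 and n\<^sub>2=0 and n\<^sub>3=0 and n\<^sub>4=1 and t\<^sub>1="- (e\<^sup>2 / (4 * c))" and t\<^sub>2=0])
      (use t in \<open>auto simp: quad_def field_simps power2_eq_square\<close>)
qed

lemma classified_second_zero:
  fixes a b c d e :: "'a::quadratic_normalization_field"
  shows "classified (planar (quad a b c d e) (quad 0 0 0 0 0))"
proof -
  \<comment> \<open>With a nonzero coefficient of \<open>x\<^sup>2\<close>, completing the square in \<open>x\<close> removes \<open>x y\<close> and \<open>x\<close>;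
     the remaining nonzero quadratic forms reach this case by exchanging the variables or by \<open>y \<mapsto> x + y\<close>.\<close>
  have lead: "classified (planar (quad a b c d e) (quad 0 0 0 0 0))" if "a \<noteq> 0" for a b c d e :: 'a
    by (rule classified_substitute[where p=1 and q="- b / (2 * a)" and h="- d / (2 * a)"
          and r=0 and s=1 and k=0
          and n\<^sub>1=a and n\<^sub>2=0 and n\<^sub>3=0 and n\<^sub>4=1 and t\<^sub>1="- (d\<^sup>2 / (4 * a))" and t\<^sub>2=0,
          OF classified_second_zero_diagonal[of "(c - b\<^sup>2 / (4 * a)) / a" "(e - b * d / (2 * a)) / a"]])
      (use that in \<open>auto simp: quad_def field_simps power2_eq_square\<close>)
  have linear: "classified (planar (quad 0 0 0 1 0) (quad 0 0 0 0 0 :: 'a \<Rightarrow> 'a \<Rightarrow> 'a))"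
    by (intro classified_normal_form) (simp add: normal_forms_def)
  consider "a \<noteq> 0" | "a = 0" "c \<noteq> 0" | "a = 0" "c = 0" "b \<noteq> 0"
    | "a = 0" "b = 0" "c = 0" "d \<noteq> 0" | "a = 0" "b = 0" "c = 0" "d = 0" "e \<noteq> 0"
    | "a = 0" "b = 0" "c = 0" "d = 0" "e = 0" by blast
  then show ?thesis
  proof cases
    case 1
    then show ?thesis by (rule lead)
  next
    case 2
    show ?thesis
      by (rule classified_substitute[where p=0 and q=1 and h=0 and r=1 and s=0 and k=0
            and n\<^sub>1=1 and n\<^sub>2=0 and n\<^sub>3=0 and n\<^sub>4=1 and t\<^sub>1=0 and t\<^sub>2=0, OF lead[of c b a e d]])
        (use 2 in \<open>auto simp: quad_def algebra_simps\<close>)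
  next
    case 3
    show ?thesis
      by (rule classified_substitute[where p=1 and q=0 and h=0 and r=1 and s=1 and k=0
            and n\<^sub>1=1 and n\<^sub>2=0 and n\<^sub>3=0 and n\<^sub>4=1 and t\<^sub>1=0 and t\<^sub>2=0, OF lead[of b b 0 "d + e" e]])
        (use 3 in \<open>auto simp: quad_def algebra_simps power2_eq_square\<close>)
  next
    case 4
    show ?thesis
      by (rule classified_substitute[where p="1/d" and q="- e/d" and h=0 and r=0 and s=1 and k=0
            and n\<^sub>1=1 and n\<^sub>2=0 and n\<^sub>3=0 and n\<^sub>4=1 and t\<^sub>1=0 and t\<^sub>2=0, OF linear])
        (use 4 in \<open>auto simp: quad_def field_simps\<close>)
  next
    case 5
    show ?thesis
      by (rule classified_substitute[where p=0 and q=1 and h=0 and r="1/e" and s=0 and k=0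
            and n\<^sub>1=1 and n\<^sub>2=0 and n\<^sub>3=0 and n\<^sub>4=1 and t\<^sub>1=0 and t\<^sub>2=0, OF linear])
        (use 5 in \<open>auto simp: quad_def field_simps\<close>)
  next
    case 6
    then show ?thesis by (intro classified_normal_form) (simp add: normal_forms_def)
  qed
qed

lemma classified_second_y_diagonal:
  fixes c :: "'a::quadratic_normalization_field"
  shows "classified (planar (quad 1 0 c 0 0) (quad 0 0 0 0 1))"
proof (cases "c = 0")
  case True
  then show ?thesis by (intro classified_normal_form) (simp add: normal_forms_def)
next
  case False
  then obtain t \<sigma> where t: "t \<noteq> 0" "c = \<sigma> * t\<^sup>2" "\<sigma> = 1 \<or> \<sigma> = - 1"
    by (rule signed_square_cases)
  have "classified (planar (quad 1 0 \<sigma> 0 0) (quad 0 0 0 0 1 :: 'a \<Rightarrow> 'a \<Rightarrow> 'a))"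
    using t(3) by (intro classified_normal_form) (auto simp: normal_forms_def)
  then show ?thesis
    by (rule classified_substitute[where p=1 and q=0 and h=0 and r=0 and s="1/t" and k=0
          and n\<^sub>1=1 and n\<^sub>2=0 and n\<^sub>3=0 and n\<^sub>4="1/t" and t\<^sub>1=0 and t\<^sub>2=0])
      (use t in \<open>auto simp: quad_def field_simps power2_eq_square\<close>)
qed

text \<open>
  Here the first component is only determined up to multiples of \<open>y\<close>, so completing the square in
  \<open>x\<close> suffices if \<open>x\<^sup>2\<close> occurs. If instead \<open>x y\<close> occurs, \<open>b x y + c y\<^sup>2\<close> is \<open>y\<close> times the new coordinate
  \<open>b x + c y\<close>, and a translation in \<open>y\<close> kills the term \<open>d x\<close>.
\<close>

lemma classified_second_y:
  fixes a b c d e :: "'a::quadratic_normalization_field"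
  shows "classified (planar (quad a b c d e) (quad 0 0 0 0 1))"
proof -
  have nf: "classified (planar (quad 0 1 0 0 0) (quad 0 0 0 0 1 :: 'a \<Rightarrow> 'a \<Rightarrow> 'a))"
    "classified (planar (quad 0 0 1 0 0) (quad 0 0 0 0 1 :: 'a \<Rightarrow> 'a \<Rightarrow> 'a))"
    "classified (planar (quad 0 0 1 1 0) (quad 0 0 0 0 1 :: 'a \<Rightarrow> 'a \<Rightarrow> 'a))"
    "classified (planar (quad 0 0 0 1 0) (quad 0 0 0 0 1 :: 'a \<Rightarrow> 'a \<Rightarrow> 'a))"
    "classified (planar (quad 0 0 0 1 0) (quad 0 0 0 0 0 :: 'a \<Rightarrow> 'a \<Rightarrow> 'a))"
    by (intro classified_normal_form; simp add: normal_forms_def)+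
  consider "a \<noteq> 0" | "a = 0" "b \<noteq> 0" | "a = 0" "b = 0" "c \<noteq> 0" "d = 0"
    | "a = 0" "b = 0" "c \<noteq> 0" "d \<noteq> 0" | "a = 0" "b = 0" "c = 0" "d \<noteq> 0"
    | "a = 0" "b = 0" "c = 0" "d = 0" by blast
  then show ?thesis
  proof cases
    case 1
    show ?thesis
      by (rule classified_substitute[where p=1 and q="- b / (2 * a)" and h="- d / (2 * a)"
            and r=0 and s=1 and k=0
            and n\<^sub>1=a and n\<^sub>2="e - b * d / (2 * a)" and n\<^sub>3=0 and n\<^sub>4=1
            and t\<^sub>1="- (d\<^sup>2 / (4 * a))" and t\<^sub>2=0,
            OF classified_second_y_diagonal[of "(c - b\<^sup>2 / (4 * a)) / a"]])
        (use 1 in \<open>auto simp: quad_def field_simps power2_eq_square\<close>)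
  next
    case 2
    show ?thesis
      by (rule classified_substitute[where p="1/b" and q="- c / b" and h=0
            and r=0 and s=1 and k="- d / b"
            and n\<^sub>1=1 and n\<^sub>2="e - 2 * c * d / b" and n\<^sub>3=0 and n\<^sub>4=1
            and t\<^sub>1="c * (d / b)\<^sup>2 - e * d / b" and t\<^sub>2="- d / b", OF nf(1)])
        (use 2 in \<open>auto simp: quad_def field_simps power2_eq_square\<close>)
  next
    case 3
    show ?thesis
      by (rule classified_substitute[where p=1 and q=0 and h=0 and r=0 and s=1 and k=0
            and n\<^sub>1=c and n\<^sub>2=e and n\<^sub>3=0 and n\<^sub>4=1 and t\<^sub>1=0 and t\<^sub>2=0, OF nf(2)])
        (use 3 in \<open>auto simp: quad_def field_simps\<close>)
  next
    case 4
    show ?thesis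
      by (rule classified_substitute[where p="c/d" and q=0 and h=0 and r=0 and s=1 and k=0
            and n\<^sub>1=c and n\<^sub>2=e and n\<^sub>3=0 and n\<^sub>4=1 and t\<^sub>1=0 and t\<^sub>2=0, OF nf(3)])
        (use 4 in \<open>auto simp: quad_def field_simps\<close>)
  next
    case 5
    show ?thesis
      by (rule classified_substitute[where p=1 and q=0 and h=0 and r=0 and s=1 and k=0
            and n\<^sub>1=d and n\<^sub>2=e and n\<^sub>3=0 and n\<^sub>4=1 and t\<^sub>1=0 and t\<^sub>2=0, OF nf(4)])
        (use 5 in \<open>auto simp: quad_def field_simps\<close>)
  next
    case 6
    show ?thesis
      by (rule classified_substitute[where p=0 and q=1 and h=0 and r=1 and s=0 and k=0
            and n\<^sub>1=e and n\<^sub>2=1 and n\<^sub>3=1 and n\<^sub>4=0 and t\<^sub>1=0 and t\<^sub>2=0, OF nf(5)])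
        (use 6 in \<open>auto simp: quad_def field_simps\<close>)
  qed
qed

lemma classified_second_linear:
  fixes a b c d e d' e' :: "'a::quadratic_normalization_field"
  shows "classified (planar (quad a b c d e) (quad 0 0 0 d' e'))"
proof -
  consider "d' = 0" "e' = 0" | "e' \<noteq> 0" | "d' \<noteq> 0" "e' = 0" by blast
  then show ?thesis
  proof cases
    case 1
    then show ?thesis using classified_second_zero by simp
  next
    case 2
    show ?thesis
      by (rule classified_substitute[where p=1 and q=0 and h=0 and r="- d' / e'" and s="1 / e'" and k=0
            and n\<^sub>1=1 and n\<^sub>2=0 and n\<^sub>3=0 and n\<^sub>4=1 and t\<^sub>1=0 and t\<^sub>2=0,
            OF classified_second_y[of "a - b * d' / e' + c * (d' / e')\<^sup>2" "b / e' - 2 * c * d' / e'\<^sup>2"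
              "c / e'\<^sup>2" "d - e * d' / e'" "e / e'"]])
        (use 2 in \<open>auto simp: quad_def field_simps power2_eq_square\<close>)
  next
    case 3
    show ?thesis
      by (rule classified_substitute[where p=0 and q="1 / d'" and h=0 and r=1 and s=0 and k=0
            and n\<^sub>1=1 and n\<^sub>2=0 and n\<^sub>3=0 and n\<^sub>4=1 and t\<^sub>1=0 and t\<^sub>2=0,
            OF classified_second_y[of c "b / d'" "a / d'\<^sup>2" e "d / d'"]])
        (use 3 in \<open>auto simp: quad_def field_simps power2_eq_square\<close>)
  qed
qed

lemma classified_if_quadratic_parts_dependent:
  fixes a b c d e a' b' c' d' e' :: "'a::quadratic_normalization_field"
  assumes "a * b' = a' * b" "a * c' = a' * c" "b * c' = b' * c"
  shows "classified (planar (quad a b c d e) (quad a' b' c' d' e'))"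
proof (cases "a' = 0 \<and> b' = 0 \<and> c' = 0")
  case True
  then show ?thesis using classified_second_linear by simp
next
  case False
  then obtain z z' where z: "z' \<noteq> 0" "z' * a = z * a'" "z' * b = z * b'" "z' * c = z * c'"
    using assms by (metis mult.commute)
  have zero: "z' * quad a b c 0 0 (1 * x + 0 * y) (0 * x + 1 * y)
      + - z * quad a' b' c' 0 0 (1 * x + 0 * y) (0 * x + 1 * y) = quad 0 0 0 0 0 x y" for x y
  proof -
    have "z' * quad a b c 0 0 x y + - z * quad a' b' c' 0 0 x y
        = (z' * a - z * a') * x\<^sup>2 + (z' * b - z * b') * x * y + (z' * c - z * c') * y\<^sup>2"
      by (simp add: quad_def algebra_simps)
    also have "\<dots> = quad 0 0 0 0 0 x y"
      unfolding z(2-4) by (simp add: quad_def)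
    finally show ?thesis by simp
  qed
  show ?thesis
    by (rule classified_by_quadratic_part[where p=1 and q=0 and r=0 and s=1 and m\<^sub>1=0 and m\<^sub>2=1
          and m\<^sub>3=z' and m\<^sub>4="- z", OF classified_second_linear[of a' b' c'] _ _ _ zero])
      (use z(1) in simp_all)
qed

section \<open>Pencils of binary quadratic forms\<close>

text \<open>
  The maps \<open>x \<mapsto> x + h\<close>, \<open>y \<mapsto> u x + s y + k\<close> preserve the pencil \<open>\<langle>x\<^sup>2, x y\<rangle>\<close>. Translations bring the
  second component to \<open>x y\<close>. If \<open>y\<close> still occurs in the first one, the shear coefficient \<open>u\<close> removes the
  term \<open>d x\<close>, provided that translations compensate what the shear does to \<open>x y\<close>.
\<close>

lemma classified_pencil_square_product:
  fixes d e d' e' :: "'a::quadratic_normalization_field"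
  shows "classified (planar (quad 1 0 0 d e) (quad 0 1 0 d' e'))"
proof -
  have nf: "classified (planar (quad 1 0 0 0 0) (quad 0 1 0 0 0 :: 'a \<Rightarrow> 'a \<Rightarrow> 'a))"
    "classified (planar (quad 1 0 0 1 0) (quad 0 1 0 0 0 :: 'a \<Rightarrow> 'a \<Rightarrow> 'a))"
    "classified (planar (quad 1 0 0 0 1) (quad 0 1 0 0 0 :: 'a \<Rightarrow> 'a \<Rightarrow> 'a))"
    by (intro classified_normal_form; simp add: normal_forms_def)+
  have red: "classified (planar (quad 1 0 0 d e) (quad 0 1 0 0 0))" for d e :: 'a
  proof -
    consider "e = 0" "d = 0" | "e = 0" "d \<noteq> 0" | "e \<noteq> 0" by blast
    then show ?thesis
    proof cases
      case 1
      then show ?thesis using nf(1) by simp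
    next
      case 2
      show ?thesis
        by (rule classified_substitute[where p=d and q=0 and h=0 and r=0 and s=1 and k=0
              and n\<^sub>1="d\<^sup>2" and n\<^sub>2=0 and n\<^sub>3=0 and n\<^sub>4=d and t\<^sub>1=0 and t\<^sub>2=0, OF nf(2)])
          (use 2 in \<open>auto simp: quad_def algebra_simps power2_eq_square\<close>)
    next
      case 3
      \<comment> \<open>Shearing by \<open>u\<close> turns \<open>x y\<close> into \<open>x y + u x\<^sup>2\<close>. Subtracting \<open>u\<close> times the first component
         creates \<open>- u e y\<close>, which the translation by \<open>e u\<close> in \<open>x\<close> cancels; together they add
         \<open>3 e u\<close> to the coefficient \<open>d\<close>.\<close>
      define u where "u = - d / (3 * e)"
      have d: "d = - 3 * e * u" using 3 by (simp add: u_def)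
      show ?thesis
        by (rule classified_substitute[where p=1 and q=0 and h="e * u" and r=u and s="1/e"
              and k="- (e * u\<^sup>2)" and n\<^sub>1=1 and n\<^sub>2=0 and n\<^sub>3=u and n\<^sub>4="1/e"
              and t\<^sub>1="- 3 * (e * u)\<^sup>2" and t\<^sub>2="- (e\<^sup>2 * u ^ 3)", OF nf(3)])
          (use 3 in \<open>auto simp: d quad_def field_simps power2_eq_square power3_eq_cube\<close>)
    qed
  qed
  show ?thesis
    by (rule classified_substitute[where p=1 and q=0 and h="- e'" and r=0 and s=1 and k="- d'"
          and n\<^sub>1=1 and n\<^sub>2=0 and n\<^sub>3=0 and n\<^sub>4=1 and t\<^sub>1="e'\<^sup>2 - d * e' - e * d'" and t\<^sub>2="- (d' * e')",
          OF red[of "d - 2 * e'" e]])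
      (auto simp: quad_def algebra_simps power2_eq_square)
qed

text \<open>
  Translations leave \<open>(x\<^sup>2 + e y, y\<^sup>2 + d' x)\<close>. Scaling \<open>x\<close> by \<open>s\<close> and \<open>y\<close> by \<open>t\<close> replaces the
  coefficients by \<open>e t / s\<^sup>2\<close> and \<open>d' s / t\<^sup>2\<close>. Both become 1 for \<open>t = s\<^sup>2 / e\<close> and \<open>s\<^sup>3 = e\<^sup>2 d'\<close>.
\<close>

lemma classified_pencil_two_squares:
  fixes d e d' e' :: "'a::quadratic_normalization_field"
  shows "classified (planar (quad 1 0 0 d e) (quad 0 0 1 d' e'))"
proof -
  have nf: "classified (planar (quad 1 0 0 0 0) (quad 0 0 1 0 0 :: 'a \<Rightarrow> 'a \<Rightarrow> 'a))"
    "classified (planar (quad 1 0 0 0 1) (quad 0 0 1 0 0 :: 'a \<Rightarrow> 'a \<Rightarrow> 'a))"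
    "classified (planar (quad 1 0 0 0 1) (quad 0 0 1 1 0 :: 'a \<Rightarrow> 'a \<Rightarrow> 'a))"
    by (intro classified_normal_form; simp add: normal_forms_def)+
  have red: "classified (planar (quad 1 0 0 0 e) (quad 0 0 1 d' 0))" for e d' :: 'a
  proof -
    consider "e = 0" "d' = 0" | "e \<noteq> 0" "d' = 0" | "e = 0" "d' \<noteq> 0" | "e \<noteq> 0" "d' \<noteq> 0" by blast
    then show ?thesis
    proof cases
      case 1
      then show ?thesis using nf(1) by simp
    next
      case 2
      show ?thesis
        by (rule classified_substitute[where p=1 and q=0 and h=0 and r=0 and s="1/e" and k=0
              and n\<^sub>1=1 and n\<^sub>2=0 and n\<^sub>3=0 and n\<^sub>4="1 / e\<^sup>2" and t\<^sub>1=0 and t\<^sub>2=0, OF nf(2)])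
          (use 2 in \<open>auto simp: quad_def field_simps power2_eq_square\<close>)
    next
      case 3
      show ?thesis
        by (rule classified_substitute[where p=0 and q="1/d'" and h=0 and r=1 and s=0 and k=0
              and n\<^sub>1=0 and n\<^sub>2="1 / d'\<^sup>2" and n\<^sub>3=1 and n\<^sub>4=0 and t\<^sub>1=0 and t\<^sub>2=0, OF nf(2)])
          (use 3 in \<open>auto simp: quad_def field_simps power2_eq_square\<close>)
    next
      case 4
      obtain s where s: "s ^ 3 = e\<^sup>2 * d'" using cube_root by blast
      then have "s \<noteq> 0" using 4 by auto
      have d': "d' = s ^ 3 / e\<^sup>2" using s 4 by simp
      show ?thesis
        by (rule classified_substitute[where p=s and q=0 and h=0 and r=0 and s="s\<^sup>2 / e" and k=0
              and n\<^sub>1="s\<^sup>2" and n\<^sub>2=0 and n\<^sub>3=0 and n\<^sub>4="s ^ 4 / e\<^sup>2" and t\<^sub>1=0 and t\<^sub>2=0, OF nf(3)])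
          (use 4 \<open>s \<noteq> 0\<close> in \<open>auto simp: d' quad_def field_simps power2_eq_square
              power3_eq_cube power4_eq_xxxx\<close>)
    qed
  qed
  show ?thesis
    by (rule classified_substitute[where p=1 and q=0 and h="- d / 2" and r=0 and s=1 and k="- e' / 2"
          and n\<^sub>1=1 and n\<^sub>2=0 and n\<^sub>3=0 and n\<^sub>4=1 and t\<^sub>1="- (d\<^sup>2 / 4) - e * e' / 2"
          and t\<^sub>2="- (e'\<^sup>2 / 4) - d * d' / 2", OF red[of e d']])
      (auto simp: quad_def field_simps power2_eq_square)
qed

text \<open>
  The pencil \<open>\<langle>x\<^sup>2 + y\<^sup>2, x y\<rangle>\<close> is spanned by the squares of \<open>x + y\<close> and \<open>x - y\<close>.
\<close>

lemma classified_pencil_sum_product: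
  fixes d e d' e' :: "'a::quadratic_normalization_field"
  shows "classified (planar (quad 1 0 1 d e) (quad 0 1 0 d' e'))"
  by (rule classified_by_quadratic_part[where p=1 and q=1 and r=1 and s="- 1" and m\<^sub>1="1/4"
        and m\<^sub>2="1/2" and m\<^sub>3="1/4" and m\<^sub>4="- 1/2", OF classified_pencil_two_squares])
    (auto simp: quad_def field_simps power2_eq_square)

text \<open>
  If \<open>i\<close> exists, \<open>y \<mapsto> i y\<close> gives the pencil \<open>\<langle>x\<^sup>2 + y\<^sup>2, x y\<rangle>\<close>. Otherwise the map is, in terms of
  \<open>z = x + i y\<close>, of the form \<open>z\<^sup>2 + \<alpha> z + \<beta> * cnj z\<close>. A translation kills \<open>\<alpha>\<close>. If \<open>\<beta>\<close> is nonzero,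
  the substitution \<open>z = w * z'\<close> with \<open>w\<^sup>2 = \<beta> * cnj w\<close> gives \<open>w\<^sup>2 * (z'\<^sup>2 + cnj z')\<close>.
\<close>

lemma classified_pencil_complex_square:
  fixes d e d' e' :: "'a::quadratic_normalization_field"
  shows "classified (planar (quad 1 0 (- 1) d e) (quad 0 2 0 d' e'))"
proof (cases "\<exists>i::'a. i\<^sup>2 = - 1")
  case True
  then obtain i :: 'a where i: "i\<^sup>2 = - 1" by blast
  then have "i \<noteq> 0" by auto
  show ?thesis
    by (rule classified_by_quadratic_part[where p=1 and q=0 and r=0 and s=i and m\<^sub>1=1
          and m\<^sub>2=0 and m\<^sub>3=0 and m\<^sub>4="1 / (2 * i)", OF classified_pencil_sum_product])
      (use i \<open>i \<noteq> 0\<close> in \<open>auto simp: quad_def power_mult_distrib\<close>)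
next
  case no_i: False
  have nf: "classified (planar (quad 1 0 (-1) 0 0) (quad 0 2 0 0 0 :: 'a \<Rightarrow> 'a \<Rightarrow> 'a))"
    "classified (planar (quad 1 0 (-1) 1 0) (quad 0 2 0 0 (-1) :: 'a \<Rightarrow> 'a \<Rightarrow> 'a))"
    by (intro classified_normal_form; simp add: normal_forms_def)+
  have red: "classified (planar (quad 1 0 (-1) p q) (quad 0 2 0 q (- p)))" for p q :: 'a
  proof (cases "p = 0 \<and> q = 0")
    case True
    then show ?thesis using nf(1) by simp
  next
    case False
    then obtain u v where uv: "u \<noteq> 0 \<or> v \<noteq> 0"
      "u\<^sup>2 - v\<^sup>2 = p * u + q * v" "2 * u * v = q * u - p * v"
      using no_i twisted_square by blast
    \<comment> \<open>The norm of \<open>u + i v\<close>, whose powers are the determinants of both linear maps.\<close>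
    have N: "u\<^sup>2 + v\<^sup>2 \<noteq> 0"
    proof
      assume z: "u\<^sup>2 + v\<^sup>2 = 0"
      then have "v \<noteq> 0" using uv(1) by auto
      then have "(u / v)\<^sup>2 = - 1"
        using z by (simp add: power_divide divide_eq_eq eq_neg_iff_add_eq_0[symmetric])
      then show False using no_i by blast
    qed
    have "(u\<^sup>2 - v\<^sup>2) * (u\<^sup>2 - v\<^sup>2) - - (2 * u * v) * (2 * u * v) = (u\<^sup>2 + v\<^sup>2)\<^sup>2"
      by (simp add: power2_eq_square algebra_simps)
    then have det: "(u\<^sup>2 - v\<^sup>2) * (u\<^sup>2 - v\<^sup>2) - - (2 * u * v) * (2 * u * v) \<noteq> 0"
      using N by simp
    show ?thesis
    proof (rule classified_substitute[where p=u and q="- v" and h=0 and r=v and s=u and k=0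
            and n\<^sub>1="u\<^sup>2 - v\<^sup>2" and n\<^sub>2="- (2 * u * v)" and n\<^sub>3="2 * u * v" and n\<^sub>4="u\<^sup>2 - v\<^sup>2"
            and t\<^sub>1=0 and t\<^sub>2=0, OF nf(2) _ det])
      show "u * u - - v * v \<noteq> 0" using N by (simp add: power2_eq_square)
      show "quad 1 0 (- 1) p q (u * x + - v * y + 0) (v * x + u * y + 0)
        = (u\<^sup>2 - v\<^sup>2) * quad 1 0 (- 1) 1 0 x y + - (2 * u * v) * quad 0 2 0 0 (- 1) x y + 0" for x y
      proof -
        have "quad 1 0 (- 1) p q (u * x + - v * y + 0) (v * x + u * y + 0)
          = (u\<^sup>2 - v\<^sup>2) * (x\<^sup>2 - y\<^sup>2) - (2 * u * v) * (2 * x * y)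
            + (p * u + q * v) * x + (q * u - p * v) * y"
          by (simp add: quad_def algebra_simps power2_eq_square)
        then show ?thesis unfolding uv(2,3)[symmetric] by (simp add: quad_def algebra_simps)
      qed
      show "quad 0 2 0 q (- p) (u * x + - v * y + 0) (v * x + u * y + 0)
        = 2 * u * v * quad 1 0 (- 1) 1 0 x y + (u\<^sup>2 - v\<^sup>2) * quad 0 2 0 0 (- 1) x y + 0" for x y
      proof -
        have "quad 0 2 0 q (- p) (u * x + - v * y + 0) (v * x + u * y + 0)
          = (2 * u * v) * (x\<^sup>2 - y\<^sup>2) + (u\<^sup>2 - v\<^sup>2) * (2 * x * y)
            + (q * u - p * v) * x - (p * u + q * v) * y"
          by (simp add: quad_def algebra_simps power2_eq_square)
        then show ?thesis unfolding uv(2,3)[symmetric] by (simp add: quad_def algebra_simps)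
      qed
    qed
  qed
  show ?thesis
    by (rule classified_substitute[where p=1 and q=0 and h="- (d + e') / 4" and r=0 and s=1
          and k="(e - d') / 4" and n\<^sub>1=1 and n\<^sub>2=0 and n\<^sub>3=0 and n\<^sub>4=1
          and t\<^sub>1="quad 1 0 (- 1) d e (- (d + e') / 4) ((e - d') / 4)"
          and t\<^sub>2="quad 0 2 0 d' e' (- (d + e') / 4) ((e - d') / 4)",
          OF red[of "(d - e') / 2" "(d' + e) / 2"]])
      (auto simp: quad_def field_simps power2_eq_square)
qed

text \<open>
  If both \<open>\<alpha>\<close> and \<open>\<gamma>\<close> are nonzero, scaling \<open>y\<close> makes \<open>\<gamma> / \<alpha>\<close> equal to 1 or \<open>- 1\<close>; if only one
  is, the second form is a multiple of a square.
\<close>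

lemma classified_pencil_with_product:
  fixes \<alpha> \<gamma> d e d' e' :: "'a::quadratic_normalization_field"
  assumes "\<alpha> \<noteq> 0 \<or> \<gamma> \<noteq> 0"
  shows "classified (planar (quad 0 1 0 d e) (quad \<alpha> 0 \<gamma> d' e'))"
proof -
  consider "\<alpha> \<noteq> 0" "\<gamma> = 0" | "\<alpha> = 0" "\<gamma> \<noteq> 0" | "\<alpha> \<noteq> 0" "\<gamma> \<noteq> 0" using assms by blast
  then show ?thesis
  proof cases
    case 1
    show ?thesis
      by (rule classified_by_quadratic_part[where p=1 and q=0 and r=0 and s=1 and m\<^sub>1=0
            and m\<^sub>2="1/\<alpha>" and m\<^sub>3=1 and m\<^sub>4=0, OF classified_pencil_square_product])
        (use 1 in \<open>auto simp: quad_def\<close>)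
  next
    case 2
    show ?thesis
      by (rule classified_by_quadratic_part[where p=0 and q=1 and r=1 and s=0 and m\<^sub>1=0
            and m\<^sub>2="1/\<gamma>" and m\<^sub>3=1 and m\<^sub>4=0, OF classified_pencil_square_product])
        (use 2 in \<open>auto simp: quad_def\<close>)
  next
    case 3
    then have "\<gamma> / \<alpha> \<noteq> 0" by simp
    then obtain t \<sigma> where t: "t \<noteq> 0" "\<gamma> / \<alpha> = \<sigma> * t\<^sup>2" and \<sigma>: "\<sigma> = 1 \<or> \<sigma> = - 1"
      by (rule signed_square_cases)
    have \<gamma>: "\<gamma> = \<alpha> * \<sigma> * t\<^sup>2" using t 3 by (simp add: field_simps)
    from \<sigma> show ?thesis
    proof
      assume "\<sigma> = 1"
      then show ?thesis
        by (intro classified_by_quadratic_part[where p=1 and q=0 and r=0 and s="1/t" and m\<^sub>1=0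
            and m\<^sub>2="1/\<alpha>" and m\<^sub>3=t and m\<^sub>4=0, OF classified_pencil_sum_product])
          (use 3 t in \<open>auto simp: quad_def \<gamma> field_simps power2_eq_square\<close>)
    next
      assume "\<sigma> = - 1"
      then show ?thesis
        by (intro classified_by_quadratic_part[where p=1 and q=0 and r=0 and s="1/t" and m\<^sub>1=0
            and m\<^sub>2="1/\<alpha>" and m\<^sub>3="2 * t" and m\<^sub>4=0, OF classified_pencil_complex_square])
          (use 3 t in \<open>auto simp: quad_def \<gamma> field_simps power2_eq_square\<close>)
    qed
  qed
qed

text \<open>
  If \<open>\<beta>\<close> is nonzero, then \<open>x\<^sup>2 + \<beta> x y\<close> is the product of \<open>x\<close> and the new coordinate
  \<open>x + \<beta> y\<close>, and symmetrically for \<open>\<gamma>\<close>. Subtracting a multiple of that product from the other form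
  leaves a diagonal form.
\<close>

lemma classified_pencil_two_shifted_squares:
  fixes \<beta> \<gamma> d e d' e' :: "'a::quadratic_normalization_field"
  shows "classified (planar (quad 1 \<beta> 0 d e) (quad 0 \<gamma> 1 d' e'))"
proof -
  consider "\<beta> = 0" "\<gamma> = 0" | "\<beta> \<noteq> 0" | "\<beta> = 0" "\<gamma> \<noteq> 0" by blast
  then show ?thesis
  proof cases
    case 1
    then show ?thesis using classified_pencil_two_squares by simp
  next
    case 2
    show ?thesis
      by (rule classified_by_quadratic_part[where p=1 and q=0 and r="- 1/\<beta>" and s="1/\<beta>" and m\<^sub>1=1
            and m\<^sub>2=0 and m\<^sub>3="2/\<beta>\<^sup>2 - \<gamma>/\<beta>" and m\<^sub>4=1,
            OF classified_pencil_with_product[of "1/\<beta>\<^sup>2 - \<gamma>/\<beta>" "1/\<beta>\<^sup>2"]])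
        (use 2 in \<open>auto simp: quad_def field_simps power2_eq_square\<close>)
  next
    case 3
    show ?thesis
      by (rule classified_by_quadratic_part[where p="1/\<gamma>" and q="- 1/\<gamma>" and r=0 and s=1 and m\<^sub>1=0
            and m\<^sub>2=1 and m\<^sub>3=1 and m\<^sub>4="2/\<gamma>\<^sup>2",
            OF classified_pencil_with_product[of "1/\<gamma>\<^sup>2" "1/\<gamma>\<^sup>2"]])
        (use 3 in \<open>auto simp: quad_def field_simps power2_eq_square\<close>)
  qed
qed

text \<open>
  Cramer's rule, depending on which minor of the coefficient matrix is nonzero. The combinations
  used are those that eliminate one coefficient; when the minor of the columns \<open>x\<^sup>2\<close> and \<open>y\<^sup>2\<close>
  vanishes, eliminating one of them from a form removes the other as well and leaves a multiple of \<open>x y\<close>.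
\<close>

lemma classified_if_quadratic_parts_independent:
  fixes a b c d e a' b' c' d' e' :: "'a::quadratic_normalization_field"
  assumes "a * b' \<noteq> a' * b \<or> a * c' \<noteq> a' * c \<or> b * c' \<noteq> b' * c"
  shows "classified (planar (quad a b c d e) (quad a' b' c' d' e'))"
proof -
  have squares: "classified (planar (quad \<delta> \<beta> 0 d e) (quad 0 \<gamma> \<delta> d' e'))" if "\<delta> \<noteq> 0"
    for \<delta> \<beta> \<gamma> d e d' e' :: 'a
    by (rule classified_by_quadratic_part[where p=1 and q=0 and r=0 and s=1 and m\<^sub>1="1 / \<delta>"
          and m\<^sub>2=0 and m\<^sub>3=0 and m\<^sub>4="1 / \<delta>",
          OF classified_pencil_two_shifted_squares[of "\<beta> / \<delta>" _ _ "\<gamma> / \<delta>"]])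
      (use that in \<open>auto simp: quad_def field_simps\<close>)
  have product: "classified (planar (quad 0 \<delta> 0 d e) (quad \<alpha> 0 \<gamma> d' e'))"
    if "\<delta> \<noteq> 0" "\<alpha> \<noteq> 0 \<or> \<gamma> \<noteq> 0" for \<delta> \<alpha> \<gamma> d e d' e' :: 'a
    by (rule classified_by_quadratic_part[where p=1 and q=0 and r=0 and s=1 and m\<^sub>1="1 / \<delta>"
          and m\<^sub>2=0 and m\<^sub>3=0 and m\<^sub>4=1, OF classified_pencil_with_product[OF that(2)]])
      (use that in \<open>auto simp: quad_def field_simps\<close>)
  have combine: "k * quad a b c 0 0 (1 * x + 0 * y) (0 * x + 1 * y)
        + l * quad a' b' c' 0 0 (1 * x + 0 * y) (0 * x + 1 * y) = quad A B C 0 0 x y"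
    if "A = k * a + l * a'" "B = k * b + l * b'" "C = k * c + l * c'" for k l x y A B C
    by (simp add: that quad_def algebra_simps)
  note rule = classified_by_quadratic_part[where p=1 and q=0 and r=0 and s=1,
      OF _ _ _ combine combine]
  consider (ac) "a * c' - a' * c \<noteq> 0"
    | (ab) "a * c' = a' * c" "a * b' - a' * b \<noteq> 0"
    | (bc) "a * c' = a' * c" "b * c' - b' * c \<noteq> 0"
    using assms by auto
  then show ?thesis
  proof cases
    case ac
    show ?thesis
      by (rule rule[OF squares[OF ac, of "c' * b - c * b'" _ _ "a * b' - a' * b"],
            where m\<^sub>1=c' and m\<^sub>2="- c" and m\<^sub>3="- a'" and m\<^sub>4=a])
        (use ac in \<open>simp_all add: algebra_simps\<close>)
  next
    case ab
    show ?thesis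
      by (rule rule[OF product[OF ab(2), of "a * b' - a' * b" "b' * c - b * c'"],
            where m\<^sub>1="- a'" and m\<^sub>2=a and m\<^sub>3=b' and m\<^sub>4="- b"])
        (use ab in \<open>simp_all add: algebra_simps\<close>)
  next
    case bc
    show ?thesis
      by (rule rule[OF product[OF bc(2), of "a * b' - a' * b" "b' * c - b * c'"],
            where m\<^sub>1=c' and m\<^sub>2="- c" and m\<^sub>3=b' and m\<^sub>4="- b"])
        (use bc in \<open>simp_all add: algebra_simps\<close>)
  qed
qed

section \<open>The classification over the real and the complex numbers\<close>

lemma finite_normal_forms: "finite normal_forms"
  by (simp add: normal_forms_def)

theorem finite_classification:
  "\<exists>G :: ('a::quadratic_normalization_field ^ 2 \<Rightarrow> 'a ^ 2) set. finite G \<and> G \<subseteq> Omega 2 2 \<and>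
      (\<forall>f \<in> Omega 2 2. \<exists>g \<in> G. linearly_equivalent f g)"
proof (intro exI conjI ballI)
  show "finite (normal_forms :: ('a ^ 2 \<Rightarrow> 'a ^ 2) set)" by (rule finite_normal_forms)
  show "(normal_forms :: ('a ^ 2 \<Rightarrow> 'a ^ 2) set) \<subseteq> Omega 2 2" by (rule normal_forms_subset)
  fix f :: "'a ^ 2 \<Rightarrow> 'a ^ 2"
  assume "f \<in> Omega 2 2"
  then obtain a b c d e t a' b' c' d' e' t' where
    f: "\<And>v. f v $ 1 = quad a b c d e (v $ 1) (v $ 2) + t"
      "\<And>v. f v $ 2 = quad a' b' c' d' e' (v $ 1) (v $ 2) + t'"
    unfolding Omega_def poly_fun_deg_le_2_iff by blast
  have "f = planar (\<lambda>x y. quad a b c d e x y + t) (\<lambda>x y. quad a' b' c' d' e' x y + t')"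
    by (simp add: fun_eq_iff vec_eq_iff forall_2 f)
  moreover have "classified (planar (quad a b c d e) (quad a' b' c' d' e'))"
    using classified_if_quadratic_parts_dependent classified_if_quadratic_parts_independent by blast
  then have "classified (planar (\<lambda>x y. quad a b c d e x y + t) (\<lambda>x y. quad a' b' c' d' e' x y + t'))"
    by (rule classified_substitute[where p=1 and q=0 and h=0 and r=0 and s=1 and k=0
          and n\<^sub>1=1 and n\<^sub>2=0 and n\<^sub>3=0 and n\<^sub>4=1 and t\<^sub>1=t and t\<^sub>2=t']) auto
  ultimately show "\<exists>g\<in>normal_forms. linearly_equivalent f g"
    unfolding classified_def by simp
qed

instance complex :: quadratic_normalization_field
proof
  fix a p q :: complex
  show "\<exists>t. a = t\<^sup>2 \<or> a = - (t\<^sup>2)"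
    by (metis power2_csqrt)
  show "\<exists>t. t ^ 3 = a"
  proof (cases "a = 0")
    case False
    then have "exp (Ln a / 3) ^ 3 = a"
      by (simp flip: exp_of_nat_mult)
    then show ?thesis by blast
  qed (auto intro: exI[of _ 0])
  show "p \<noteq> 0 \<or> q \<noteq> 0 \<Longrightarrow> (\<nexists>i::complex. i\<^sup>2 = - 1) \<Longrightarrow>
      (\<exists>u v. (u \<noteq> 0 \<or> v \<noteq> 0) \<and> u\<^sup>2 - v\<^sup>2 = p * u + q * v \<and> 2 * u * v = q * u - p * v)"
    using power2_i by blast
qed

instance real :: quadratic_normalization_field
proof
  fix a p q :: real
  show "\<exists>t. a = t\<^sup>2 \<or> a = - (t\<^sup>2)"
    by (rule exI[of _ "sqrt \<bar>a\<bar>"]) (auto simp: abs_if)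
  show "\<exists>t. t ^ 3 = a"
    by (rule exI[of _ "root 3 a"]) (simp add: odd_real_root_pow)
  have "\<exists>u v. (u \<noteq> 0 \<or> v \<noteq> 0) \<and> u\<^sup>2 - v\<^sup>2 = p * u + q * v \<and> 2 * u * v = q * u - p * v"
    if "p \<noteq> 0 \<or> q \<noteq> 0"
  proof -
    \<comment> \<open>Polar form: \<open>w\<^sup>2 = \<beta> * cnj w\<close> holds if \<open>w\<close> has the modulus and a third of the argument of \<open>\<beta>\<close>.\<close>
    define \<beta> where "\<beta> = Complex p q"
    define w where "w = rcis (cmod \<beta>) (Arg \<beta> / 3)"
    have "\<beta> \<noteq> 0" using that by (auto simp: \<beta>_def complex_eq_iff)
    then have "w \<noteq> 0" by (simp add: w_def)
    have "\<beta> * cnj w = rcis (cmod \<beta>) (Arg \<beta>) * rcis (cmod \<beta>) (- (Arg \<beta> / 3))"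
      unfolding rcis_cmod_Arg by (simp add: w_def rcis_def cis_cnj)
    also have "\<dots> = w\<^sup>2"
      by (simp add: w_def power2_eq_square rcis_mult)
    finally have "w\<^sup>2 = \<beta> * cnj w" by simp
    then have "(Re w)\<^sup>2 - (Im w)\<^sup>2 = p * Re w + q * Im w"
      "2 * Re w * Im w = q * Re w - p * Im w"
      by (auto simp: complex_eq_iff power2_eq_square \<beta>_def mult_ac)
    moreover have "Re w \<noteq> 0 \<or> Im w \<noteq> 0"
      using \<open>w \<noteq> 0\<close> by (auto simp: complex_eq_iff)
    ultimately show ?thesis by blast
  qed
  then show "p \<noteq> 0 \<or> q \<noteq> 0 \<Longrightarrow> (\<nexists>i::real. i\<^sup>2 = - 1) \<Longrightarrow>
      (\<exists>u v. (u \<noteq> 0 \<or> v \<noteq> 0) \<and> u\<^sup>2 - v\<^sup>2 = p * u + q * v \<and> 2 * u * v = q * u - p * v)"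
    by blast
qed

theorem mainTheorem1:
  "(\<exists>G :: (complex ^ 2 \<Rightarrow> complex ^ 2) set. finite G \<and> G \<subseteq> Omega 2 2 \<and>
      (\<forall>f \<in> Omega 2 2. \<exists>g \<in> G. linearly_equivalent f g)) \<and>
   (\<exists>G :: (real ^ 2 \<Rightarrow> real ^ 2) set. finite G \<and> G \<subseteq> Omega 2 2 \<and>
      (\<forall>f \<in> Omega 2 2. \<exists>g \<in> G. linearly_equivalent f g))"
  using finite_classification[where 'a=complex] finite_classification[where 'a=real] by blast

end
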